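(* Let $D\ge3$, $\delta=2(D-2)$, $\mu\neq0$, $\omega\in\mathbb{R}$, let $f>0$ be a metric function and $h>0$ an arbitrary enthalpy function, and set $$F(r,n)=h(n)^2\left[f(r)+\frac{\mu^2}{r^{\delta}n^2}\right]\Omega(r),\qquad \Omega(r)=\frac{1}{1-\omega^2f(r)r^{-2}} .$$ Let $v_s^2(n)=\dfrac{d\ln h}{d\ln n}$ and, at radii where $(r^\delta\Omega^{-1})'$ and $(f\Omega)'$ are nonzero and of the same sign, define $$\bar n(r)=\frac{|\mu|}{r^\delta\Omega^{-1}}\sqrt{\frac{(r^\delta\Omega^{-1})'}{(f\Omega)'}},\qquad \mathcal{F}(r)=v_s^2(\bar n(r))\left[1+\frac{(r^\delta\Omega^{-1})'}{r^\delta\Omega^{-1}}\,\frac{f\Omega}{(f\Omega)'}\right]-1 .$$ Then: (i) at every critical point $(r_c,n_c)$ of $F$, $(r^\delta\Omega^{-1})'\ne0$ and $(f\Omega)'\neq0$, and these have the same sign; moreover a phase-space point $(r_c,n_c)$ is a critical point of $F$ if and only if $(r^\delta\Omega^{-1})'$ and $(f\Omega)'$ are nonzero and of the same sign at $r_c$, $\mathcal{F}(r_c)=0$ and $n_c=\bar n(r_c)$; (ii) at a critical point $(r_c,n_c)$, $$\det M_c=-\frac{(r^\delta\Omega^{-1})_c}{(r^\delta\Omega^{-1})'_c}\,\frac{4h_c^4}{n_c^2}\,\big((f\Omega)'_c\big)^2\,\mathcal{F}'(r_c),$$ and consequently $(r_c,n_c)$ is a saddle (resp. extremum) point if and only if $(f\Omega)'_c\,\mathcal{F}'(r_c)>0$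 (resp. $<0$).
   Context: $f$ is a positive twice continuously differentiable function of $r>0$ on the radial interval considered ($-f$ is the $tt$ component of a static spherically symmetric metric in $D$ dimensions), and $h$ is a positive twice continuously differentiable function of the number density $n>0$. The equation $F(r,n)=\mathrm{const}$ describes a stationary rotating thin-disk accretion flow. The phase space is the set of $(r,n)$ with $r$ in the radial interval, $n>0$ and $1-\omega^2f(r)r^{-2}>0$ (so $\Omega(r)>0$). Primes denote $d/dr$, and the subscript $c$ denotes evaluation at $(r_c,n_c)$. A critical point is a phase-space point with $\partial_rF=\partial_nF=0$. Put $\det M_c=(\partial_r^2F)_c(\partial_n^2F)_c-(\partial_r\partial_nF)_c^2$. The critical point is a saddle point if $\det M_c<0$ and an extremum point if $\det M_c>0$. *)

theory Defs
  imports "HOL-Analysis.Analysis"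
begin

(* Intended for open S: both C1_differentiable_on and deriv use two-sided derivatives. *)
definition C2_on :: "(real \<Rightarrow> real) \<Rightarrow> real set \<Rightarrow> bool" where
  "C2_on g S \<longleftrightarrow> g C1_differentiable_on S \<and> deriv g C1_differentiable_on S"

definition Omega :: "real \<Rightarrow> (real \<Rightarrow> real) \<Rightarrow> real \<Rightarrow> real" where
  "Omega \<omega> f r = 1 / (1 - \<omega>\<^sup>2 * f r / r\<^sup>2)"

definition rOmegaInv :: "nat \<Rightarrow> real \<Rightarrow> (real \<Rightarrow> real) \<Rightarrow> real \<Rightarrow> real" where
  "rOmegaInv \<delta> \<omega> f r = r ^ \<delta> * inverse (Omega \<omega> f r)"

definition fOmega :: "real \<Rightarrow> (real \<Rightarrow> real) \<Rightarrow> real \<Rightarrow> real" where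
  "fOmega \<omega> f r = f r * Omega \<omega> f r"

definition flowF :: "nat \<Rightarrow> real \<Rightarrow> real \<Rightarrow> (real \<Rightarrow> real) \<Rightarrow> (real \<Rightarrow> real) \<Rightarrow> real \<Rightarrow> real \<Rightarrow> real" where
  "flowF \<delta> \<mu> \<omega> f h r n = (h n)\<^sup>2 * (f r + \<mu>\<^sup>2 / (r ^ \<delta> * n\<^sup>2)) * Omega \<omega> f r"

(* d(ln h)/d(ln n), i.e. the derivative of x |-> ln (h (exp x)) at x = ln n; meant for n > 0. *)
definition vs2 :: "(real \<Rightarrow> real) \<Rightarrow> real \<Rightarrow> real" where
  "vs2 h n = deriv (\<lambda>x. ln (h (exp x))) (ln n)"

(* The radii at which nbar and calF are meaningful; elsewhere their values are unspecified. *)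
definition admissible_radius :: "nat \<Rightarrow> real \<Rightarrow> (real \<Rightarrow> real) \<Rightarrow> real \<Rightarrow> bool" where
  "admissible_radius \<delta> \<omega> f r \<longleftrightarrow>
     deriv (rOmegaInv \<delta> \<omega> f) r \<noteq> 0 \<and> deriv (fOmega \<omega> f) r \<noteq> 0 \<and>
     sgn (deriv (rOmegaInv \<delta> \<omega> f) r) = sgn (deriv (fOmega \<omega> f) r)"

definition nbar :: "nat \<Rightarrow> real \<Rightarrow> real \<Rightarrow> (real \<Rightarrow> real) \<Rightarrow> real \<Rightarrow> real" where
  "nbar \<delta> \<mu> \<omega> f r =
     \<bar>\<mu>\<bar> / rOmegaInv \<delta> \<omega> f r * sqrt (deriv (rOmegaInv \<delta> \<omega> f) r / deriv (fOmega \<omega> f) r)"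

definition calF :: "nat \<Rightarrow> real \<Rightarrow> real \<Rightarrow> (real \<Rightarrow> real) \<Rightarrow> (real \<Rightarrow> real) \<Rightarrow> real \<Rightarrow> real" where
  "calF \<delta> \<mu> \<omega> f h r =
     vs2 h (nbar \<delta> \<mu> \<omega> f r) *
       (1 + deriv (rOmegaInv \<delta> \<omega> f) r / rOmegaInv \<delta> \<omega> f r *
            (fOmega \<omega> f r / deriv (fOmega \<omega> f) r)) - 1"

definition phase_space :: "real set \<Rightarrow> real \<Rightarrow> (real \<Rightarrow> real) \<Rightarrow> (real \<times> real) set" where
  "phase_space I \<omega> f = {(r, n). r \<in> I \<and> n > 0 \<and> 1 - \<omega>\<^sup>2 * f r / r\<^sup>2 > 0}"

definition pd_r :: "(real \<Rightarrow> real \<Rightarrow> real) \<Rightarrow> real \<Rightarrow> real \<Rightarrow> real" where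
  "pd_r G r n = deriv (\<lambda>s. G s n) r"

definition pd_n :: "(real \<Rightarrow> real \<Rightarrow> real) \<Rightarrow> real \<Rightarrow> real \<Rightarrow> real" where
  "pd_n G r n = deriv (\<lambda>m. G r m) n"

definition detM :: "(real \<Rightarrow> real \<Rightarrow> real) \<Rightarrow> real \<Rightarrow> real \<Rightarrow> real" where
  "detM G r n = pd_r (pd_r G) r n * pd_n (pd_n G) r n - (pd_r (pd_n G) r n)\<^sup>2"

definition critical_point :: "(real \<times> real) set \<Rightarrow> (real \<Rightarrow> real \<Rightarrow> real) \<Rightarrow> real \<Rightarrow> real \<Rightarrow> bool" where
  "critical_point P G r n \<longleftrightarrow> (r, n) \<in> P \<and> pd_r G r n = 0 \<and> pd_n G r n = 0"

definition saddle_point :: "(real \<times> real) set \<Rightarrow> (real \<Rightarrow> real \<Rightarrow> real) \<Rightarrow> real \<Rightarrow> real \<Rightarrow> bool" where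
  "saddle_point P G r n \<longleftrightarrow> critical_point P G r n \<and> detM G r n < 0"

definition extremum_point :: "(real \<times> real) set \<Rightarrow> (real \<Rightarrow> real \<Rightarrow> real) \<Rightarrow> real \<Rightarrow> real \<Rightarrow> bool" where
  "extremum_point P G r n \<longleftrightarrow> critical_point P G r n \<and> detM G r n > 0"

end

theory Submission imports Defs begin

text \<open>With A = r^\<delta> / \<Omega> and B = f \<Omega> one has F = h^2 (B + \<mu>^2 / (A n^2)).
Then F_r = h^2 (B' - \<mu>^2 A' / (A^2 n^2)), whose zero set is the graph of nbar, while
F_n is 2 h^2 / n times a function G whose restriction to that graph is (A B' / A') calF.
Differentiating F_r = 0 along the graph expresses F_rr through F_rn, which turns the Hessian
determinant into the derivative of G along the graph. The derivatives A' and B' cannot vanish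
together: A' = B' = 0 would force 1 - \<omega>^2 f / r^2 to be both decreasing and nondecreasing.\<close>

section \<open>Sound speed and second-order regularity\<close>

lemma vs2_eq:
  assumes "h differentiable (at n)" "n > 0" "h n > 0"
  shows "vs2 h n = n * deriv h n / h n"
proof -
  have "(h has_real_derivative deriv h n) (at (exp (ln n)))"
    using assms by (simp add: DERIV_deriv_iff_real_differentiable)
  from DERIV_chain2[OF this DERIV_exp]
  have "((\<lambda>x. h (exp x)) has_real_derivative deriv h n * n) (at (ln n))"
    using assms by simp
  from DERIV_chain2[where f = ln, OF _ this, of "1 / h n"]
  have "((\<lambda>x. ln (h (exp x))) has_real_derivative 1 / h n * (deriv h n * n)) (at (ln n))"
    using assms by (simp add: DERIV_ln_divide)
  then show ?thesis
    unfolding vs2_def by (simp add: DERIV_imp_deriv mult.commute)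
qed

lemma C2_onD:
  assumes "C2_on g S" "x \<in> S"
  shows "g differentiable (at x)" "deriv g differentiable (at x)"
  using assms unfolding C2_on_def C1_differentiable_on_eq by auto

section \<open>Separation into radial functions A and B\<close>

lemma flowF_separated:
  "flowF \<delta> \<mu> \<omega> f h r n =
     (h n)\<^sup>2 * (fOmega \<omega> f r + \<mu>\<^sup>2 / (rOmegaInv \<delta> \<omega> f r * n\<^sup>2))"
  unfolding flowF_def fOmega_def rOmegaInv_def
  by (simp add: divide_inverse algebra_simps)

text \<open>The analysis sees the metric only through A, B and their first two derivatives, so it is
  done for an arbitrary such pair. The one trace of the special form of A and B is
  \<open>derivs_nonzero\<close>. Openness of \<open>U\<close> lets identities valid on
  \<open>U\<close> be differentiated again.\<close>

locale separated_flow =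
  fixes A B h :: "real \<Rightarrow> real" and \<mu> :: real and U :: "real set"
  assumes open_U: "open U"
    and mu: "\<mu> \<noteq> 0"
    and A_pos: "r \<in> U \<Longrightarrow> A r > 0" and B_pos: "r \<in> U \<Longrightarrow> B r > 0"
    and A_diff: "r \<in> U \<Longrightarrow> A differentiable (at r)"
    and A'_diff: "r \<in> U \<Longrightarrow> deriv A differentiable (at r)"
    and B_diff: "r \<in> U \<Longrightarrow> B differentiable (at r)"
    and B'_diff: "r \<in> U \<Longrightarrow> deriv B differentiable (at r)"
    and derivs_nonzero: "r \<in> U \<Longrightarrow> deriv A r \<noteq> 0 \<or> deriv B r \<noteq> 0"
    and h_pos: "n > 0 \<Longrightarrow> h n > 0"
    and h_diff: "n > 0 \<Longrightarrow> h differentiable (at n)"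
    and h'_diff: "n > 0 \<Longrightarrow> deriv h differentiable (at n)"
begin

definition F :: "real \<Rightarrow> real \<Rightarrow> real" where
  "F r n = (h n)\<^sup>2 * (B r + \<mu>\<^sup>2 / (A r * n\<^sup>2))"

definition K :: "real \<Rightarrow> real \<Rightarrow> real" where
  "K r n = deriv B r - \<mu>\<^sup>2 * deriv A r / ((A r)\<^sup>2 * n\<^sup>2)"

definition G :: "real \<Rightarrow> real \<Rightarrow> real" where
  "G r n = vs2 h n * (B r + \<mu>\<^sup>2 / (A r * n\<^sup>2)) - \<mu>\<^sup>2 / (A r * n\<^sup>2)"

definition crit_density :: "real \<Rightarrow> real" where
  "crit_density r = \<bar>\<mu>\<bar> / A r * sqrt (deriv A r / deriv B r)"

definition crit_fun :: "real \<Rightarrow> real" where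
  "crit_fun r = vs2 h (crit_density r) * (1 + deriv A r / A r * (B r / deriv B r)) - 1"

definition admissible :: "real \<Rightarrow> bool" where
  "admissible r \<longleftrightarrow> deriv A r \<noteq> 0 \<and> deriv B r \<noteq> 0 \<and> sgn (deriv A r) = sgn (deriv B r)"

lemma DERIV_A: "r \<in> U \<Longrightarrow> (A has_real_derivative deriv A r) (at r)"
  and DERIV_A': "r \<in> U \<Longrightarrow> (deriv A has_real_derivative deriv (deriv A) r) (at r)"
  and DERIV_B: "r \<in> U \<Longrightarrow> (B has_real_derivative deriv B r) (at r)"
  and DERIV_B': "r \<in> U \<Longrightarrow> (deriv B has_real_derivative deriv (deriv B) r) (at r)"
  and DERIV_h: "n > 0 \<Longrightarrow> (h has_real_derivative deriv h n) (at n)"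
  using A_diff A'_diff B_diff B'_diff h_diff
  by (simp_all add: DERIV_deriv_iff_real_differentiable)

lemma DERIV_vs2:
  assumes "n > 0"
  shows "(vs2 h has_real_derivative deriv (vs2 h) n) (at n)"
proof -
  have "(deriv h has_real_derivative deriv (deriv h) n) (at n)"
    using h'_diff[OF assms] by (simp add: DERIV_deriv_iff_real_differentiable)
  then have "\<exists>D. ((\<lambda>m. m * deriv h m / h m) has_real_derivative D) (at n)"
    using DERIV_h[OF assms] h_pos[OF assms] by (auto intro!: exI derivative_eq_intros)
  then obtain D where "((\<lambda>m. m * deriv h m / h m) has_real_derivative D) (at n)" ..
  \<comment> \<open>The quotient formula agrees with \<open>vs2 h\<close> only for positive
    densities, hence the transfer on the open half-line. An unnamed \<open>D\<close> suffices: this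
    derivative will enter F_nn and \<open>deriv crit_fun\<close> with matching coefficients.\<close>
  then have "(vs2 h has_real_derivative D) (at n)"
    by (rule has_field_derivative_transform_within_open[of _ _ _ "{0<..}"])
       (use assms vs2_eq h_diff h_pos in auto)
  then show ?thesis by (simp add: DERIV_imp_deriv)
qed

section \<open>First partial derivatives and the critical curve\<close>

lemma pd_r_F:
  assumes "r \<in> U" "n > 0"
  shows "pd_r F r n = (h n)\<^sup>2 * K r n"
  unfolding pd_r_def F_def K_def using A_pos[OF assms(1)] assms
  by (intro DERIV_imp_deriv)
     (auto intro!: derivative_eq_intros DERIV_A DERIV_B simp: field_simps power2_eq_square)

lemma pd_n_F:
  assumes "r \<in> U" "n > 0"
  shows "pd_n F r n = 2 * (h n)\<^sup>2 / n * G r n"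
  unfolding pd_n_def F_def G_def vs2_eq[OF h_diff[OF assms(2)] assms(2) h_pos[OF assms(2)]]
  using A_pos[OF assms(1)] h_pos[OF assms(2)] assms
  by (intro DERIV_imp_deriv)
     (auto intro!: derivative_eq_intros DERIV_h simp: field_simps power2_eq_square)

text \<open>Division by zero yields zero, so a positive quotient already forces both derivatives to
  be nonzero.\<close>

lemma admissible_iff_ratio_pos: "admissible r \<longleftrightarrow> deriv A r / deriv B r > 0"
  unfolding admissible_def by (auto simp: sgn_if zero_less_divide_iff split: if_splits)

lemma crit_density_pos: "r \<in> U \<Longrightarrow> admissible r \<Longrightarrow> crit_density r > 0"
  unfolding crit_density_def admissible_iff_ratio_pos using mu A_pos by simp

lemma crit_density_sq:
  assumes "admissible r"
  shows "(crit_density r)\<^sup>2 = \<mu>\<^sup>2 / (A r)\<^sup>2 * (deriv A r / deriv B r)"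
  using assms unfolding crit_density_def admissible_iff_ratio_pos
  by (simp add: power_mult_distrib power_divide)

text \<open>Vanishing of \<open>K\<close> means B' = c A' with c = \<mu>^2 / (A^2 n^2) > 0. Hence A'
  and B' have the same sign, and if one vanished so would the other, against
  \<open>derivs_nonzero\<close>. Solving for n^2 and taking the positive root gives the
  density.\<close>

lemma K_zero_iff:
  assumes "r \<in> U" "n > 0"
  shows "K r n = 0 \<longleftrightarrow> admissible r \<and> n = crit_density r"
proof
  assume K: "K r n = 0"
  have A: "A r > 0" using A_pos assms by simp
  have eq: "deriv B r = \<mu>\<^sup>2 / ((A r)\<^sup>2 * n\<^sup>2) * deriv A r"
    using K unfolding K_def by simp
  have c: "\<mu>\<^sup>2 / ((A r)\<^sup>2 * n\<^sup>2) > 0" using mu A assms by simp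
  have A': "deriv A r \<noteq> 0" using derivs_nonzero[OF assms(1)] eq by auto
  have adm: "admissible r"
    unfolding admissible_iff_ratio_pos eq using A' c by (simp add: zero_less_divide_iff)
  have "n\<^sup>2 = (crit_density r)\<^sup>2"
    unfolding crit_density_sq[OF adm] eq using A' A mu assms by (simp add: field_simps)
  then have "n = crit_density r"
    using crit_density_pos[OF assms(1) adm] assms(2) by (simp add: power2_eq_iff_nonneg)
  with adm show "admissible r \<and> n = crit_density r" by simp
next
  assume *: "admissible r \<and> n = crit_density r"
  then have sq: "n\<^sup>2 = \<mu>\<^sup>2 / (A r)\<^sup>2 * (deriv A r / deriv B r)"
    by (simp add: crit_density_sq)
  show "K r n = 0" unfolding K_def sq
    using * mu A_pos[OF assms(1)] by (simp add: admissible_def)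
qed

lemma pressure_on_curve:
  assumes "r \<in> U" "admissible r"
  shows "\<mu>\<^sup>2 / (A r * (crit_density r)\<^sup>2) = A r * deriv B r / deriv A r"
  using assms mu A_pos[OF assms(1)] unfolding crit_density_sq[OF assms(2)] admissible_def
  by (simp add: field_simps power2_eq_square)

text \<open>With q = A B' / A' and v the value of \<open>vs2 h\<close>, \<open>G\<close> on the
  curve is v (B + q) - q = q (v (1 + B / q) - 1), and B / q is exactly the product appearing in
  \<open>crit_fun\<close>.\<close>

lemma G_on_curve:
  assumes "r \<in> U" "admissible r"
  shows "G r (crit_density r) = A r * deriv B r / deriv A r * crit_fun r"
  using assms A_pos[OF assms(1)]
  unfolding G_def crit_fun_def pressure_on_curve[OF assms] admissible_def
  by (simp add: field_simps)

lemma critical_iff: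
  assumes "r \<in> U" "n > 0"
  shows "pd_r F r n = 0 \<and> pd_n F r n = 0 \<longleftrightarrow>
    admissible r \<and> crit_fun r = 0 \<and> n = crit_density r"
proof -
  have "pd_r F r n = 0 \<longleftrightarrow> admissible r \<and> n = crit_density r"
    using pd_r_F[OF assms] h_pos[OF assms(2)] K_zero_iff[OF assms] by simp
  moreover have "pd_n F r n = 0 \<longleftrightarrow> crit_fun r = 0" if "admissible r" "n = crit_density r"
    using pd_n_F[OF assms] G_on_curve[OF assms(1)] that h_pos[OF assms(2)] A_pos[OF assms(1)] assms
    unfolding admissible_def by auto
  ultimately show ?thesis by blast
qed

section \<open>Derivatives along the curve and the Hessian determinant\<close>

definition log_slope :: "real \<Rightarrow> real" where
  "log_slope r = deriv (deriv A) r / (2 * deriv A r) - deriv (deriv B) r / (2 * deriv B r)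
     - deriv A r / A r"

text \<open>Logarithmic differentiation: ln of the density is ln |\<mu>| - ln A + (ln (A' / B')) /
  2, and \<open>log_slope\<close> is the derivative of this expression.\<close>

lemma DERIV_crit_density:
  assumes "r \<in> U" "admissible r"
  shows "(crit_density has_real_derivative crit_density r * log_slope r) (at r)"
proof -
  define q where "q = (\<lambda>r. deriv A r / deriv B r)"
  have q: "q r > 0" using assms unfolding q_def admissible_iff_ratio_pos by simp
  have nz: "deriv A r \<noteq> 0" "deriv B r \<noteq> 0" "A r > 0"
    using assms A_pos unfolding admissible_def by auto
  have dq: "(q has_real_derivative
      q r * (deriv (deriv A) r / deriv A r - deriv (deriv B) r / deriv B r)) (at r)"
    unfolding q_def using nz assms
    by (auto intro!: derivative_eq_intros DERIV_A' DERIV_B' simp: field_simps)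
  have "((\<lambda>r. sqrt (q r)) has_real_derivative
      sqrt (q r) * (deriv (deriv A) r / deriv A r - deriv (deriv B) r / deriv B r) / 2) (at r)"
    using DERIV_chain2[OF DERIV_real_sqrt[OF q] dq]
    \<comment> \<open>The chain rule yields \<open>inverse (sqrt (q r))\<close>; written as
      \<open>sqrt (q r) / q r\<close>, it cancels the factor \<open>q r\<close> of the inner
      derivative.\<close>
    by (rule DERIV_cong) (use q sqrt_divide_self_eq[of "q r", symmetric] in simp)
  note dsqrt = this
  have dinv: "((\<lambda>r. \<bar>\<mu>\<bar> / A r) has_real_derivative
      - (\<bar>\<mu>\<bar> / A r) * (deriv A r / A r)) (at r)"
    using nz assms by (auto intro!: derivative_eq_intros DERIV_A)
  have "crit_density = (\<lambda>r. \<bar>\<mu>\<bar> / A r * sqrt (q r))"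
    unfolding crit_density_def[abs_def] q_def ..
  then show ?thesis
    using DERIV_mult[OF dinv dsqrt] by
      (simp add: log_slope_def algebra_simps add_divide_distrib diff_divide_distrib)
qed

lemma DERIV_crit_fun:
  assumes "r \<in> U" "admissible r"
  shows "(crit_fun has_real_derivative
    deriv (vs2 h) (crit_density r) * (crit_density r * log_slope r)
        * (1 + deriv A r / A r * (B r / deriv B r))
      + vs2 h (crit_density r) * (deriv A r / A r)
        * (1 + B r / deriv B r * (deriv (deriv A) r / deriv A r - deriv A r / A r
             - deriv (deriv B) r / deriv B r))) (at r)"
proof -
  have nz: "deriv A r \<noteq> 0" "deriv B r \<noteq> 0" "A r \<noteq> 0"
    using assms A_pos[of r] unfolding admissible_def by auto
  have v: "((\<lambda>r. vs2 h (crit_density r)) has_real_derivative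
      deriv (vs2 h) (crit_density r) * (crit_density r * log_slope r)) (at r)"
    using DERIV_chain2[OF DERIV_vs2[OF crit_density_pos[OF assms]] DERIV_crit_density[OF assms]] .
  \<comment> \<open>Differentiating the factor B of the product A' B / (A B') contributes the
    summand 1; the other three factors contribute their logarithmic derivatives.\<close>
  have W: "((\<lambda>r. 1 + deriv A r / A r * (B r / deriv B r)) has_real_derivative
      deriv A r / A r * (1 + B r / deriv B r * (deriv (deriv A) r / deriv A r - deriv A r / A r
             - deriv (deriv B) r / deriv B r))) (at r)"
    using nz assms
    by (auto intro!: derivative_eq_intros DERIV_A DERIV_A' DERIV_B DERIV_B'
        simp: field_simps)
  show ?thesis
    unfolding crit_fun_def[abs_def]
    by (rule DERIV_cong[OF DERIV_diff[OF DERIV_mult[OF v W] DERIV_const]]) (simp add: algebra_simps)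
qed

text \<open>Write v, v' for \<open>vs2 h\<close> and its derivative at n, L for
  \<open>log_slope r\<close> and q = A B' / A'. The second derivatives are F_rr = -2 h^2 B' L, F_rn
  = 2 h^2 B' / n and F_nn = (2 h^2 / n) (v' (B + q) + 2 q (1 - v) / n). Their determinant is -(4 h^4
  B' / n^2) times q \<open>deriv crit_fun r\<close>.\<close>

lemma detM_critical:
  assumes r: "r \<in> U" and adm: "admissible r" and zero: "crit_fun r = 0"
    and n: "n = crit_density r"
  shows "detM F r n = - (A r / deriv A r) * (4 * (h n) ^ 4 / n\<^sup>2) * (deriv B r)\<^sup>2
    * deriv crit_fun r"
proof -
  define q where "q = A r * deriv B r / deriv A r"
  define v where "v = vs2 h n"
  define v' where "v' = deriv (vs2 h) n"
  define L where "L = log_slope r"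
  have nz: "deriv A r \<noteq> 0" "deriv B r \<noteq> 0" "A r > 0" "B r > 0"
    using r adm A_pos B_pos unfolding admissible_def by auto
  have np: "n > 0" using crit_density_pos[OF r adm] n by simp
  have G0: "G r n = 0" using G_on_curve[OF r adm] zero n by simp
  have K0: "K r n = 0" using K_zero_iff[OF r np] adm n by simp
  have q: "\<mu>\<^sup>2 / (A r * n\<^sup>2) = q"
    using pressure_on_curve[OF r adm] n unfolding q_def by simp
  \<comment> \<open>Here \<open>q\<close>, \<open>A r\<close> and \<open>n\<close> are frozen at the
    critical point, so \<mu>^2 stays a constant in the differentiations below.\<close>
  have mu2: "\<mu>\<^sup>2 = q * A r * n\<^sup>2" using q nz np by (simp add: field_simps)

  \<comment> \<open>The value is predicted by differentiating K = 0 along the curve: K_r + K_n n L =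
    0 with K_n = 2 B' / n. The proof checks it directly.\<close>
  have K_r: "((\<lambda>s. K s n) has_real_derivative - 2 * deriv B r * L) (at r)"
    unfolding K_def mu2 L_def log_slope_def q_def using nz np r
    by (auto intro!: derivative_eq_intros DERIV_A DERIV_A' DERIV_B'
        simp: field_simps power2_eq_square)
  have "((\<lambda>s. pd_r F s n) has_real_derivative (h n)\<^sup>2 * (- 2 * deriv B r * L)) (at r)"
    by (rule has_field_derivative_transform_within_open[OF DERIV_cmult[OF K_r] open_U r])
       (simp add: pd_r_F np)
  then have rr: "pd_r (pd_r F) r n = (h n)\<^sup>2 * (- 2 * deriv B r * L)"
    unfolding pd_r_def[of "pd_r F"] by (rule DERIV_imp_deriv)

  have G_r: "((\<lambda>s. G s n) has_real_derivative deriv B r) (at r)"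
  proof -
    \<comment> \<open>The radial derivative of B + \<mu>^2 / (A n^2) is \<open>K\<close>, and that
      of \<mu>^2 / (A n^2) is K - B'. At K = 0 the sound speed drops out.\<close>
    have "((\<lambda>s. G s n) has_real_derivative v * K r n + (deriv B r - K r n)) (at r)"
      unfolding G_def K_def v_def using nz np r
      by (auto intro!: derivative_eq_intros DERIV_A DERIV_B simp: field_simps power2_eq_square)
    then show ?thesis by (simp add: K0)
  qed
  have "((\<lambda>s. pd_n F s n) has_real_derivative 2 * (h n)\<^sup>2 / n * deriv B r) (at r)"
    by (rule has_field_derivative_transform_within_open[OF DERIV_cmult[OF G_r] open_U r])
       (simp add: pd_n_F np)
  then have rn: "pd_r (pd_n F) r n = 2 * (h n)\<^sup>2 / n * deriv B r"
    unfolding pd_r_def by (rule DERIV_imp_deriv)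

  have p_n: "((\<lambda>m. \<mu>\<^sup>2 / (A r * m\<^sup>2)) has_real_derivative - 2 * q / n) (at n)"
    unfolding mu2 using nz np
    by (auto intro!: derivative_eq_intros simp: field_simps power2_eq_square)
  have G_n: "((\<lambda>m. G r m) has_real_derivative v' * (B r + q) + 2 * q * (1 - v) / n) (at n)"
    unfolding G_def
    by (rule derivative_eq_intros DERIV_vs2[OF np] p_n refl)+
       (use np in \<open>simp add: q v_def v'_def field_simps\<close>)
  \<comment> \<open>The derivative of the prefactor may stay implicit, since the product rule
    multiplies it by \<open>G r n\<close>, which is zero here.\<close>
  have c_n: "((\<lambda>m. 2 * (h m)\<^sup>2 / m) has_real_derivative deriv (\<lambda>m. 2 * (h m)\<^sup>2 / m) n) (at n)"
  proof -
    have "\<exists>D. ((\<lambda>m. 2 * (h m)\<^sup>2 / m) has_real_derivative D) (at n)"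
      using DERIV_h[OF np] np by (auto intro!: exI derivative_eq_intros)
    then show ?thesis using DERIV_imp_deriv by metis
  qed
  have "((\<lambda>m. pd_n F r m) has_real_derivative
      2 * (h n)\<^sup>2 / n * (v' * (B r + q) + 2 * q * (1 - v) / n)) (at n)"
  proof (rule has_field_derivative_transform_within_open[of _ _ _ "{0<..}"])
    show "((\<lambda>m. 2 * (h m)\<^sup>2 / m * G r m) has_real_derivative
      2 * (h n)\<^sup>2 / n * (v' * (B r + q) + 2 * q * (1 - v) / n)) (at n)"
      using DERIV_mult[OF c_n G_n] by (simp add: G0 mult.commute)
  qed (use np r in \<open>auto simp: pd_n_F\<close>)
  then have nn: "pd_n (pd_n F) r n = 2 * (h n)\<^sup>2 / n * (v' * (B r + q) + 2 * q * (1 - v) / n)"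
    unfolding pd_n_def[of "pd_n F"] by (rule DERIV_imp_deriv)

  define W where "W = 1 + deriv A r / A r * (B r / deriv B r)"
  define W' where "W' = deriv A r / A r * (1 + B r / deriv B r *
    (deriv (deriv A) r / deriv A r - deriv A r / A r - deriv (deriv B) r / deriv B r))"
  have crit': "deriv crit_fun r = v' * (n * L) * W + v * W'"
    using DERIV_imp_deriv[OF DERIV_crit_fun[OF r adm]]
    unfolding v_def v'_def W_def W'_def L_def n by (simp add: mult.assoc)
  \<comment> \<open>The critical condition enters as v W = 1. Since 2 L = A'' / A' - B'' / B' - 2 A'
    / A, the derivative of W can be expressed by W, L and A' / A; then v W = 1 removes W from v
    W'.\<close>
  have vW: "v * W = 1" using zero unfolding crit_fun_def v_def W_def n by simp
  have qW: "q * W = B r + q" unfolding q_def W_def using nz by (simp add: field_simps)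
  have W'_eq: "W' = 2 * (W - 1) * L + W * (deriv A r / A r)"
    unfolding W'_def W_def L_def log_slope_def using nz by (simp add: field_simps)
  have "v * W' = 2 * (v * W - v) * L + (v * W) * (deriv A r / A r)"
    unfolding W'_eq by (simp add: algebra_simps)
  then have vW': "v * W' = 2 * (1 - v) * L + deriv A r / A r"
    unfolding vW by simp
  \<comment> \<open>Eliminating A' in favour of q turns q A' / A into B', the term that F_rn^2
    contributes.\<close>
  have A': "deriv A r = A r * deriv B r / q" unfolding q_def using nz by simp
  have "q \<noteq> 0" unfolding q_def using nz by simp
  show ?thesis
    unfolding detM_def rr nn rn crit' vW' qW[symmetric] A'
    using nz np \<open>q \<noteq> 0\<close> by (simp add: field_simps power2_eq_square power4_eq_xxxx)
qed

text \<open>Since \<open>deriv\<close> is total, this is what makes \<open>deriv crit_fun\<close> a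
  genuine derivative in the determinant formula.\<close>

lemma crit_fun_differentiable:
  "r \<in> U \<Longrightarrow> admissible r \<Longrightarrow> crit_fun differentiable (at r)"
  using DERIV_crit_fun real_differentiable_def by blast

lemma detM_sign:
  assumes "r \<in> U" "admissible r" "crit_fun r = 0" "n = crit_density r"
  shows "detM F r n < 0 \<longleftrightarrow> deriv B r * deriv crit_fun r > 0"
    and "detM F r n > 0 \<longleftrightarrow> deriv B r * deriv crit_fun r < 0"
proof -
  have n: "n > 0" using crit_density_pos[OF assms(1,2)] assms(4) by simp
  \<comment> \<open>One factor of (B')^2 is paired with 1 / A', giving a positive ratio at
    admissible radii; the other factor B' keeps its sign and remains in the criterion.\<close>
  define c where "c = A r * (4 * (h n) ^ 4 / n\<^sup>2) * (deriv B r / deriv A r)"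
  have ratio: "deriv B r / deriv A r > 0"
    using assms(2) unfolding admissible_iff_ratio_pos by (auto simp: zero_less_divide_iff)
  have "A r * (4 * (h n) ^ 4 / n\<^sup>2) > 0" using n h_pos[OF n] A_pos[OF assms(1)] by simp
  then have c: "c > 0" unfolding c_def using ratio by (rule mult_pos_pos)
  have "detM F r n = - (c * (deriv B r * deriv crit_fun r))"
    unfolding detM_critical[OF assms] c_def by (simp add: power2_eq_square mult_ac)
  then show "detM F r n < 0 \<longleftrightarrow> deriv B r * deriv crit_fun r > 0"
    and "detM F r n > 0 \<longleftrightarrow> deriv B r * deriv crit_fun r < 0"
    using c by (simp_all add: zero_less_mult_iff mult_less_0_iff)
qed

end

section \<open>The radial functions of the metric satisfy the abstract hypotheses\<close>

lemma metric_derivs_nonzero: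
  assumes r: "r > 0" and f: "(f has_real_derivative f') (at r)" "f r > 0"
    and u: "1 - \<omega>\<^sup>2 * f r / r\<^sup>2 > 0" and \<delta>: "\<delta> > 0"
  shows "deriv (rOmegaInv \<delta> \<omega> f) r \<noteq> 0 \<or> deriv (fOmega \<omega> f) r \<noteq> 0"
proof (rule ccontr)
  assume "\<not> ?thesis"
  then have zero: "deriv (rOmegaInv \<delta> \<omega> f) r = 0" "deriv (fOmega \<omega> f) r = 0" by auto
  define u where "u = (\<lambda>r. 1 - \<omega>\<^sup>2 * f r / r\<^sup>2)"
  define u' where "u' = - \<omega>\<^sup>2 * (f' / r\<^sup>2 - 2 * f r / r ^ 3)"
  have up: "u r > 0" using assms unfolding u_def by simp
  have du: "(u has_real_derivative u') (at r)"
    unfolding u_def u'_def using r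
    by (auto intro!: derivative_eq_intros f simp: field_simps power2_eq_square power3_eq_cube)
  have A: "rOmegaInv \<delta> \<omega> f = (\<lambda>r. r ^ \<delta> * u r)"
    and B: "fOmega \<omega> f = (\<lambda>r. f r / u r)"
    unfolding rOmegaInv_def[abs_def] fOmega_def[abs_def] Omega_def u_def by simp_all
  have "((\<lambda>r. r ^ \<delta> * u r) has_real_derivative r ^ \<delta> * (\<delta> * u r / r + u')) (at r)"
    \<comment> \<open>Since \<delta> > 0, r^\<delta> splits as r times r^(\<delta> - 1), matching
      the exponent produced by the power rule.\<close>
    using r \<delta> by (auto intro!: derivative_eq_intros du simp: field_simps power_eq_if[of r \<delta>])
  from DERIV_imp_deriv[OF this] have u'_eq: "u' = - \<delta> * u r / r"
    using zero(1) r unfolding A by simp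
  have "((\<lambda>r. f r / u r) has_real_derivative (f' * u r - f r * u') / (u r * u r)) (at r)"
    using up by (auto intro!: derivative_eq_intros du f)
  from DERIV_imp_deriv[OF this] have "f' * u r = f r * u'"
    using zero(2) up unfolding B by simp
  then have "f' * u r = (- \<delta> * f r / r) * u r" unfolding u'_eq by simp
  then have f': "f' = - \<delta> * f r / r" using up by (metis less_irrefl mult_right_cancel)
  \<comment> \<open>Both f and u now have logarithmic derivative -\<delta> / r, so f / r^2 has
    derivative -(\<delta> + 2) f / r^3. Only a weak inequality for \<open>u'\<close> follows, as
    \<omega> may be zero; the strict one comes from \<open>u'_eq\<close>.\<close>
  have "u' = \<omega>\<^sup>2 * (\<delta> + 2) * f r / r ^ 3"
    unfolding u'_def f' using r by (simp add: field_simps power2_eq_square power3_eq_cube)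
  then have "u' \<ge> 0" using f r by simp
  moreover have "u' < 0" unfolding u'_eq using up r \<delta> by simp
  ultimately show False by simp
qed

text \<open>The region where 1 - \<omega>^2 f / r^2 > 0 is open by continuity. The closed forms of
  A' and B' therefore hold near each of its points, and their differentiability passes to
  \<open>deriv\<close> of A and B.\<close>

lemma separated_flow_metric:
  assumes \<delta>: "\<delta> > 0" and mu: "\<mu> \<noteq> 0" and I: "open I" "I \<subseteq> {0<..}"
    and f: "C2_on f I" "\<And>r. r \<in> I \<Longrightarrow> f r > 0"
    and h: "C2_on h {0<..}" "\<And>n. n > 0 \<Longrightarrow> h n > 0"
  shows "separated_flow (rOmegaInv \<delta> \<omega> f) (fOmega \<omega> f) h \<mu> {r \<in> I. 1 - \<omega>\<^sup>2 * f r / r\<^sup>2 > 0}"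
proof -
  define u where "u = (\<lambda>r. 1 - \<omega>\<^sup>2 * f r / r\<^sup>2)"
  define U where "U = {r \<in> I. u r > 0}"
  have A: "rOmegaInv \<delta> \<omega> f = (\<lambda>r. r ^ \<delta> * u r)"
    and B: "fOmega \<omega> f = (\<lambda>r. f r / u r)"
    unfolding rOmegaInv_def[abs_def] fOmega_def[abs_def] Omega_def u_def by simp_all
  have df: "(f has_real_derivative deriv f r) (at r)"
    and df': "(deriv f has_real_derivative deriv (deriv f) r) (at r)" if "r \<in> I" for r
    using C2_onD[OF f(1) that] by (simp_all add: DERIV_deriv_iff_real_differentiable)
  have pos: "r > 0" "f r > 0" if "r \<in> I" for r using that I f by auto
  define u' where "u' = (\<lambda>r. - \<omega>\<^sup>2 * (deriv f r / r\<^sup>2 - 2 * f r / r ^ 3))"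
  have du: "(u has_real_derivative u' r) (at r)" if "r \<in> I" for r
    unfolding u_def u'_def using pos[OF that] that
    by (auto intro!: derivative_eq_intros df simp: field_simps power2_eq_square power3_eq_cube)
  have du': "u' differentiable (at r)" if "r \<in> I" for r
  proof -
    have "\<exists>D. (u' has_real_derivative D) (at r)"
      unfolding u'_def using pos[OF that] df[OF that] df'[OF that]
      by (auto intro!: exI derivative_eq_intros)
    then show ?thesis by (simp add: real_differentiable_def)
  qed
  have "continuous_on I u"
    using du DERIV_isCont continuous_at_imp_continuous_on by blast
  then have "open (u -` {0<..} \<inter> I)"
    using I(1) continuous_on_open_vimage open_greaterThan by blast
  moreover have "u -` {0<..} \<inter> I = U" unfolding U_def by auto
  ultimately have openU: "open U" by simp

  define A' where "A' = (\<lambda>r::real. \<delta> * r ^ (\<delta> - 1) * u r + r ^ \<delta> * u' r)"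
  define B' where "B' = (\<lambda>r. (deriv f r * u r - f r * u' r) / (u r * u r))"
  have dA: "(rOmegaInv \<delta> \<omega> f has_real_derivative A' r) (at r)" if "r \<in> U" for r
    unfolding A A'_def using that unfolding U_def
    by (auto intro!: derivative_eq_intros du)
  have dB: "(fOmega \<omega> f has_real_derivative B' r) (at r)" if "r \<in> U" for r
    unfolding B B'_def using that unfolding U_def
    by (auto intro!: derivative_eq_intros du df)
  have u_differentiable: "u differentiable (at r)" if "r \<in> U" for r
    using du that unfolding U_def real_differentiable_def by blast
  have "A' differentiable (at r)" if "r \<in> U" for r
    unfolding A'_def using that u_differentiable[OF that] du'[of r] unfolding U_def
    by (auto intro!: derivative_intros)
  then have ddA: "deriv (rOmegaInv \<delta> \<omega> f) differentiable (at r)" if "r \<in> U" for r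
    using that dA openU unfolding real_differentiable_def
    by (metis DERIV_imp_deriv has_field_derivative_transform_within_open)
  have "B' differentiable (at r)" if "r \<in> U" for r
    unfolding B'_def using that u_differentiable[OF that] du'[of r] C2_onD[OF f(1), of r]
    unfolding U_def by (auto intro!: derivative_intros)
  then have ddB: "deriv (fOmega \<omega> f) differentiable (at r)" if "r \<in> U" for r
    using that dB openU unfolding real_differentiable_def
    by (metis DERIV_imp_deriv has_field_derivative_transform_within_open)

  have "separated_flow (rOmegaInv \<delta> \<omega> f) (fOmega \<omega> f) h \<mu> U"
  proof
    fix r assume r: "r \<in> U"
    then have rI: "r \<in> I" and up: "u r > 0" unfolding U_def by auto
    show "rOmegaInv \<delta> \<omega> f r > 0" "fOmega \<omega> f r > 0"
      unfolding A B using pos[OF rI] up by simp_all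
    show "rOmegaInv \<delta> \<omega> f differentiable (at r)" "fOmega \<omega> f differentiable (at r)"
      using dA[OF r] dB[OF r] unfolding real_differentiable_def by blast+
    show "deriv (rOmegaInv \<delta> \<omega> f) r \<noteq> 0 \<or> deriv (fOmega \<omega> f) r \<noteq> 0"
      using metric_derivs_nonzero[OF _ df[OF rI] _ _ \<delta>] pos[OF rI] up unfolding u_def by blast
  qed (use openU mu ddA ddB h C2_onD[OF h(1)] in auto)
  then show ?thesis unfolding U_def u_def .
qed

section \<open>Transfer to the accretion flow\<close>

theorem mainTheorem3:
  fixes D \<delta> :: nat and \<mu> \<omega> :: real and f h :: "real \<Rightarrow> real" and I :: "real set"
  assumes "D \<ge> 3" and "\<delta> = 2 * (D - 2)" and "\<mu> \<noteq> 0"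
    and "is_interval I" and "open I" and "I \<subseteq> {0<..}"
    and "C2_on f I" and "\<And>r. r \<in> I \<Longrightarrow> f r > 0"
    and "C2_on h {0<..}" and "\<And>n. n > 0 \<Longrightarrow> h n > 0"
  shows
    "(\<forall>r\<^sub>c n\<^sub>c. critical_point (phase_space I \<omega> f) (flowF \<delta> \<mu> \<omega> f h) r\<^sub>c n\<^sub>c \<longrightarrow>
        admissible_radius \<delta> \<omega> f r\<^sub>c) \<and>
     (\<forall>(r\<^sub>c, n\<^sub>c) \<in> phase_space I \<omega> f.
        critical_point (phase_space I \<omega> f) (flowF \<delta> \<mu> \<omega> f h) r\<^sub>c n\<^sub>c \<longleftrightarrow>
        admissible_radius \<delta> \<omega> f r\<^sub>c \<and> calF \<delta> \<mu> \<omega> f h r\<^sub>c = 0 \<and> n\<^sub>c = nbar \<delta> \<mu> \<omega> f r\<^sub>c) \<and>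
     (\<forall>r\<^sub>c n\<^sub>c. critical_point (phase_space I \<omega> f) (flowF \<delta> \<mu> \<omega> f h) r\<^sub>c n\<^sub>c \<longrightarrow>
        calF \<delta> \<mu> \<omega> f h differentiable (at r\<^sub>c) \<and>
        detM (flowF \<delta> \<mu> \<omega> f h) r\<^sub>c n\<^sub>c =
          - (rOmegaInv \<delta> \<omega> f r\<^sub>c / deriv (rOmegaInv \<delta> \<omega> f) r\<^sub>c) *
            (4 * (h n\<^sub>c) ^ 4 / n\<^sub>c\<^sup>2) * (deriv (fOmega \<omega> f) r\<^sub>c)\<^sup>2 *
            deriv (calF \<delta> \<mu> \<omega> f h) r\<^sub>c \<and>
        (saddle_point (phase_space I \<omega> f) (flowF \<delta> \<mu> \<omega> f h) r\<^sub>c n\<^sub>c \<longleftrightarrow>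
           deriv (fOmega \<omega> f) r\<^sub>c * deriv (calF \<delta> \<mu> \<omega> f h) r\<^sub>c > 0) \<and>
        (extremum_point (phase_space I \<omega> f) (flowF \<delta> \<mu> \<omega> f h) r\<^sub>c n\<^sub>c \<longleftrightarrow>
           deriv (fOmega \<omega> f) r\<^sub>c * deriv (calF \<delta> \<mu> \<omega> f h) r\<^sub>c < 0))"
proof -
  let ?U = "{r \<in> I. 1 - \<omega>\<^sup>2 * f r / r\<^sup>2 > 0}"
  have "\<delta> > 0" using assms(1,2) by simp
  then interpret separated_flow "rOmegaInv \<delta> \<omega> f" "fOmega \<omega> f" h \<mu> ?U
    by (rule separated_flow_metric) (use assms in auto)
  \<comment> \<open>These identities hold at all arguments, even outside the phase space (with
    division by zero equal to zero), so they can be rewritten under \<open>deriv\<close>.\<close>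
  have F: "flowF \<delta> \<mu> \<omega> f h = F"
    by (intro ext) (simp add: flowF_separated F_def)
  have dens: "nbar \<delta> \<mu> \<omega> f = crit_density"
    by (intro ext) (simp add: nbar_def crit_density_def)
  have cal: "calF \<delta> \<mu> \<omega> f h = crit_fun"
    by (intro ext) (simp add: calF_def crit_fun_def dens)
  have adm: "admissible_radius \<delta> \<omega> f = admissible"
    by (intro ext) (simp add: admissible_radius_def admissible_def)
  have ps: "(r, n) \<in> phase_space I \<omega> f \<longleftrightarrow> r \<in> ?U \<and> n > 0" for r n
    unfolding phase_space_def by auto
  have crit: "critical_point (phase_space I \<omega> f) F r n \<longleftrightarrow>
      r \<in> ?U \<and> n > 0 \<and> admissible r \<and> crit_fun r = 0 \<and> n = crit_density r" for r n
    unfolding critical_point_def ps using critical_iff[of r n] by blast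
  show ?thesis
    unfolding F dens cal adm saddle_point_def extremum_point_def
  proof (intro conjI allI impI)
    fix r n assume "critical_point (phase_space I \<omega> f) F r n"
    then show "admissible r" using crit by blast
  next
    show "\<forall>(r, n) \<in> phase_space I \<omega> f. critical_point (phase_space I \<omega> f) F r n \<longleftrightarrow>
        admissible r \<and> crit_fun r = 0 \<and> n = crit_density r"
      using crit ps by blast
  next
    fix r n assume c: "critical_point (phase_space I \<omega> f) F r n"
    then have *: "r \<in> ?U" "admissible r" "crit_fun r = 0" "n = crit_density r"
      using crit by blast+
    show "crit_fun differentiable (at r)"
      using crit_fun_differentiable * by blast
    show "detM F r n = - (rOmegaInv \<delta> \<omega> f r / deriv (rOmegaInv \<delta> \<omega> f) r) *
            (4 * (h n) ^ 4 / n\<^sup>2) * (deriv (fOmega \<omega> f) r)\<^sup>2 * deriv crit_fun r"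
      by (rule detM_critical[OF *])
    show "critical_point (phase_space I \<omega> f) F r n \<and> detM F r n < 0 \<longleftrightarrow>
        deriv (fOmega \<omega> f) r * deriv crit_fun r > 0"
      using c detM_sign(1)[OF *] by blast
    show "critical_point (phase_space I \<omega> f) F r n \<and> detM F r n > 0 \<longleftrightarrow>
        deriv (fOmega \<omega> f) r * deriv crit_fun r < 0"
      using c detM_sign(2)[OF *] by blast
  qed
qed

end
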